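(* Let $n\ge2$ and let $\mathbf{v}_1,\dots,\mathbf{v}_n\in\mathbb{R}^n$ be linearly independent unit vectors that are not all pairwise orthogonal. Let $V$ be the matrix with columns $\mathbf{v}_1,\dots,\mathbf{v}_n$, suppose that $V^TV$ is tridiagonal (i.e. $\mathbf{v}_i\cdot\mathbf{v}_j=0$ whenever $|i-j|\ge2$), let $\beta_i=\mathbf{v}_i\cdot\mathbf{v}_{i+1}$ for $1\le i\le n-1$, and let $\lambda_{\min}$ be the smallest eigenvalue of $V^TV$. Then for any $\rho$ such that $1-\lambda_{\min}<\rho<1$, there exist partial degrees $(N_1,\dots,N_{n-1})\in\mathbb{N}^{n-1}$ such that for any integer $\ell\ge1$, $$E(N_1+\ell,\dots,N_{n-1}+\ell)\le\rho^\ell\,E(N_1,\dots,N_{n-1}).$$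
   Context: For $\mathbf{b}=(b_1,\dots,b_{n-1})\in\mathbb{N}^{n-1}$ (with $\mathbb{N}$ including $0$), and with $b_0=b_n=0$, put $$A_{\mathbf{b}}=\frac{(-2)^{\sum_{i=1}^{n-1} b_i}}{\prod_{i=1}^{n-1}b_i!}\prod_{i=1}^{n}\Gamma\!\left(\frac{1+b_{i-1}+b_i}{2}\right),\qquad \boldsymbol\beta^{\mathbf{b}}=\beta_1^{b_1}\cdots\beta_{n-1}^{b_{n-1}}\quad(0^0=1).$$ For partial degrees $(N_1,\dots,N_{n-1})\in\mathbb{N}^{n-1}$, the series truncation error is $$E(N_1,\dots,N_{n-1})=\sum_{\mathbf{b}\in B}\left|A_{\mathbf{b}}\boldsymbol\beta^{\mathbf{b}}\right|,\qquad B=\{\mathbf{b}\in\mathbb{N}^{n-1}\mid b_i\ge N_i\text{ for at least one }i\}.$$ *)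

theory Defs
  imports "HOL-Analysis.Analysis" "Jordan_Normal_Form.Spectral_Radius"
begin

text \<open>
  Vectors of \<open>\<real>\<^sup>n\<close> are those of \<^typ>\<open>real vec\<close> with carrier \<open>carrier_vec n\<close>, and
  \<open>\<bullet>\<close> is the dot product \<^const>\<open>scalar_prod\<close>; the homonymous notation for \<^const>\<open>inner\<close>
  is switched off.
\<close>

no_notation inner (infix \<open>\<bullet>\<close> 70)

text \<open>
  Multi-indices \<open>b = (b\<^sub>1, \<dots>, b\<^sub>n\<^sub>-\<^sub>1)\<close> are functions on \<^typ>\<open>nat\<close> vanishing outside
  \<open>{1..n-1}\<close>, which incorporates the convention \<open>b\<^sub>0 = b\<^sub>n = 0\<close>.
\<close>

definition multi_indices :: "nat \<Rightarrow> (nat \<Rightarrow> nat) set" where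
  "multi_indices n = {b. \<forall>i. i \<notin> {1..<n} \<longrightarrow> b i = 0}"

definition series_coeff :: "nat \<Rightarrow> (nat \<Rightarrow> nat) \<Rightarrow> real" where
  "series_coeff n b =
     (- 2) ^ (\<Sum>i\<in>{1..<n}. b i) / (\<Prod>i\<in>{1..<n}. fact (b i))
       * (\<Prod>i\<in>{1..n}. Gamma ((1 + real (b (i - 1)) + real (b i)) / 2))"

definition monomial_at :: "nat \<Rightarrow> (nat \<Rightarrow> real) \<Rightarrow> (nat \<Rightarrow> nat) \<Rightarrow> real" where
  "monomial_at n \<beta> b = (\<Prod>i\<in>{1..<n}. \<beta> i ^ b i)"

definition trunc_indices :: "nat \<Rightarrow> (nat \<Rightarrow> nat) \<Rightarrow> (nat \<Rightarrow> nat) set" where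
  "trunc_indices n N = {b \<in> multi_indices n. \<exists>i\<in>{1..<n}. b i \<ge> N i}"

text \<open>
  Only \<open>N\<^sub>1, \<dots>, N\<^sub>n\<^sub>-\<^sub>1\<close> matter. The sum is taken in \<^typ>\<open>ennreal\<close>, where it always exists,
  so that a divergent series has error \<open>\<infinity>\<close> instead of the default value \<open>0\<close> of \<^const>\<open>infsum\<close>.
\<close>

definition trunc_error :: "nat \<Rightarrow> (nat \<Rightarrow> real) \<Rightarrow> (nat \<Rightarrow> nat) \<Rightarrow> ennreal" where
  "trunc_error n \<beta> N =
     (\<Sum>\<^sub>\<infinity>b\<in>trunc_indices n N. ennreal \<bar>series_coeff n b * monomial_at n \<beta> b\<bar>)"

text \<open>
  Linear independence of the family \<open>v\<^sub>1, \<dots>, v\<^sub>n\<close>, as opposed to that of the set of its values: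
  hence injectivity.
\<close>

definition lin_indpt_family :: "nat \<Rightarrow> (nat \<Rightarrow> real vec) \<Rightarrow> bool" where
  "lin_indpt_family n v \<longleftrightarrow> inj_on v {1..n} \<and>
     \<not> LinearCombinations.module.lin_dep class_ring (module_vec TYPE(real) n) (v ` {1..n})"

end

theory Submission
  imports Defs
begin

text \<open>
  Fix \<open>1 - \<lambda>\<^sub>m\<^sub>i\<^sub>n < \<sigma> < \<tau> < \<rho>\<close>. The tridiagonal matrix with unit diagonal and off-diagonal entries
  \<open>\<beta>\<^sub>i / \<sigma>\<close> is positive definite, so its elimination pivots are positive. Absorbing the indices
  \<open>b\<^sub>1, b\<^sub>2, \<dots>\<close> one at a time, each at the cost of one pivot (the discrete counterpart of integrating out
  one variable of a Gaussian at a time), bounds the series for \<open>\<beta> / \<sigma>\<close> termwise, that is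
  \<open>\<bar>A\<^sub>b \<beta>\<^sup>b\<bar> \<le> K \<sigma>\<^bsup>b\<^sub>1 + \<dots> + b\<^sub>n\<^sub>-\<^sub>1\<^esup>\<close>. Hence \<open>E(m, \<dots>, m) = O(\<tau>\<^sup>m)\<close> and
  \<open>E(m, \<dots>, m) / \<rho>\<^sup>m\<close> tends to \<open>0\<close>; if \<open>m\<close> maximizes this quotient, then
  \<open>N = (m, \<dots>, m)\<close> satisfies all the inequalities at once.
\<close>

section \<open>Gamma function estimates for one elimination step\<close>

text \<open>Restrict Euler's integral for \<open>B(y + 1, s)\<close> to \<open>[t, 1]\<close>, where \<open>u\<^sup>y \<ge> t\<^sup>y\<close>.\<close>

lemma Gamma_real_add_bound:
  fixes s y t :: real
  assumes "s > 0" "y \<ge> 0" "0 \<le> t" "t < 1"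
  shows "Gamma (s + y) * t powr y * (1 - t) powr s \<le> Gamma s * Gamma (y + 1)"
proof -
  have B: "((\<lambda>u. u powr y * (1 - u) powr (s - 1)) has_integral Beta (y + 1) s) {0..1}"
    using has_integral_Beta_real[of "y + 1" s] assms by simp
  \<comment> \<open>For \<open>s < 1\<close> the integrand is unbounded near 1, but its
    antiderivative is continuous there, so the derivative is needed only in the open
    interval.\<close>
  have "((\<lambda>u. (1 - u) powr (s - 1)) has_integral
          (- ((1 - 1) powr s / s) - (- ((1 - t) powr s / s)))) {t..1}"
  proof (rule fundamental_theorem_of_calculus_interior)
    show "continuous_on {t..1} (\<lambda>u. - ((1 - u) powr s / s))"
      using assms by (intro continuous_intros continuous_on_powr') auto
    show "((\<lambda>u. - ((1 - u) powr s / s)) has_vector_derivative (1 - x) powr (s - 1)) (at x)"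
      if "x \<in> {t<..<1}" for x
      unfolding has_real_derivative_iff_has_vector_derivative[symmetric]
      using that assms by (auto intro!: derivative_eq_intros simp: field_simps)
  qed (use assms in auto)
  from has_integral_mult_right[OF this, of "t powr y"]
  have "((\<lambda>u. t powr y * (1 - u) powr (s - 1)) has_integral t powr y * ((1 - t) powr s / s)) {t..1}"
    using assms by simp
  then have "((\<lambda>u. if u \<in> {t..1} then t powr y * (1 - u) powr (s - 1) else 0)
      has_integral t powr y * ((1 - t) powr s / s)) {0..1}"
    using assms by (subst has_integral_restrict) auto
  then have "t powr y * ((1 - t) powr s / s) \<le> Beta (y + 1) s"
    by (rule has_integral_le[OF _ B]) (use assms in \<open>auto intro!: mult_right_mono powr_mono2\<close>)
  then have 1: "t powr y * (1 - t) powr s \<le> s * Beta (y + 1) s"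
    using assms by (simp add: field_simps)
  \<comment> \<open>The denominator of \<open>Beta\<close> is \<open>Gamma (s + y + 1)\<close>.
    Lowering its argument by one leaves the factor s / (s + y), which is at most 1 and is dropped
    below.\<close>
  have "Beta (y + 1) s = Gamma (y + 1) * Gamma s / ((s + y) * Gamma (s + y))"
    using assms Gamma_plus1[of "s + y"] by (simp add: Beta_def add_ac nonpos_Ints_def)
  moreover have aux: "g * (s * B) = s / c * (q * p)" if "B = p * q / (c * g)" "g > 0" "c > 0" for B p q c g :: real
    using that by simp
  moreover have "Gamma (s + y) > 0" using assms by (intro Gamma_real_pos) auto
  moreover have "s + y > 0" using assms by simp
  ultimately have "Gamma (s + y) * (s * Beta (y + 1) s) = s / (s + y) * (Gamma s * Gamma (y + 1))"
    using aux by blast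
  also have "\<dots> \<le> 1 * (Gamma s * Gamma (y + 1))"
    using assms by (intro mult_right_mono) auto
  finally have "Gamma (s + y) * (s * Beta (y + 1) s) \<le> Gamma s * Gamma (y + 1)" by simp
  moreover have "Gamma (s + y) * (t powr y * (1 - t) powr s) \<le> Gamma (s + y) * (s * Beta (y + 1) s)"
    using assms by (intro mult_left_mono[OF 1]) (auto intro!: Gamma_real_nonneg)
  ultimately show ?thesis by (simp add: mult.assoc)
qed

text \<open>Legendre duplication at half-integers. Raising b by one swaps the two Gamma arguments
  and shifts one of them by 1, so induction needs only the functional equation.\<close>

lemma Gamma_half_duplication:
  "Gamma ((1 + real b) / 2) * Gamma (real b / 2 + 1) * 2 ^ b = sqrt pi * fact b"
proof (induction b)
  case 0
  show ?case by (simp add: Gamma_one_half_real)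
next
  case (Suc b)
  have "Gamma ((1 + real b) / 2 + 1) = (1 + real b) / 2 * Gamma ((1 + real b) / 2)"
    by (rule Gamma_plus1) (auto simp: nonpos_Ints_def)
  then have "Gamma (real (Suc b) / 2 + 1) = (1 + real b) / 2 * Gamma ((1 + real b) / 2)" by simp
  moreover have "Gamma ((1 + real (Suc b)) / 2) = Gamma (real b / 2 + 1)"
    by (simp add: add_divide_distrib add.commute)
  ultimately have "Gamma ((1 + real (Suc b)) / 2) * Gamma (real (Suc b) / 2 + 1) * 2 ^ Suc b
     = (1 + real b) * (Gamma ((1 + real b) / 2) * Gamma (real b / 2 + 1) * 2 ^ b)"
    by simp
  then show ?case
    by (simp only: Suc.IH) simp
qed

text \<open>One elimination step: d is the current pivot, 1 - g^2/d the next one, b the index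
  absorbed and c its successor. With t = g^2/d the power t^(b/2) collects g^b and the b-dependent
  part of the power of d. \<open>Gamma_real_add_bound\<close> then applies, and duplication cancels
  \<open>Gamma (y + 1)\<close>.\<close>

lemma Gamma_term_bound:
  fixes g d :: real
  assumes "g \<ge> 0" "d > 0" "g\<^sup>2 < d"
  shows "Gamma ((1 + real b) / 2) * d powr (- (1 + real b) / 2) * ((2 * g) ^ b / fact b)
           * Gamma ((1 + real b + real c) / 2)
         \<le> sqrt pi * d powr (- 1 / 2) * (Gamma ((1 + real c) / 2) * (1 - g\<^sup>2 / d) powr (- (1 + real c) / 2))"
proof (cases "g = 0")
  case True
  have "0 \<le> sqrt pi * d powr (- 1 / 2) * Gamma ((1 + real c) / 2)"
    by (intro mult_nonneg_nonneg Gamma_real_nonneg) auto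
  then show ?thesis using True by (cases "b = 0") (simp_all add: Gamma_one_half_real mult.assoc power_0_left)
next
  case False
  define s t y where "s = (1 + real c) / 2" and "t = g\<^sup>2 / d" and "y = real b / 2"
  have t: "0 \<le> t" "t < 1" using assms by (auto simp: t_def)
  have sy: "s > 0" "y \<ge> 0" by (auto simp: s_def y_def)
  have sum: "s + y = (1 + real b + real c) / 2" by (simp add: s_def y_def field_simps)
  have pos: "Gamma (s + y) > 0" "Gamma (y + 1) > 0" using sy by (auto intro!: Gamma_real_pos)
  have ty: "d powr (- (1 + real b) / 2) * g ^ b = d powr (- 1 / 2) * t powr y"
  proof -
    \<comment> \<open>Since \<open>0 powr 0 = 0\<close> while \<open>0 ^ 0 = 1\<close>, this
      rewriting fails for g = 0 and b = 0; hence the separate case g = 0.\<close>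
    have g: "g > 0" using False assms by simp
    then have "g\<^sup>2 powr y = g ^ b"
      by (simp add: y_def powr_powr flip: powr_realpow powr_numeral)
    then have "t powr y = g ^ b * d powr (- y)"
      using assms g by (simp add: t_def powr_divide powr_minus_divide)
    moreover have "d powr (- (1 + real b) / 2) = d powr (- 1 / 2) * d powr (- y)"
      by (simp add: y_def add_divide_distrib diff_divide_distrib flip: powr_add)
    ultimately show ?thesis by simp
  qed
  have "Gamma (s + y) * t powr y \<le> Gamma s * Gamma (y + 1) * (1 - t) powr (- s)"
  proof -
    have "(1 - t) powr s > 0" using t by simp
    with Gamma_real_add_bound[OF sy t] show ?thesis
      by (simp only: powr_minus pos_le_divide_eq flip: divide_inverse)
  qed
  then have *: "Gamma (s + y) * t powr y / Gamma (y + 1) \<le> Gamma s * (1 - t) powr (- s)"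
    using pos(2) by (simp only: pos_divide_le_eq mult_ac)
  have dup: "Gamma ((1 + real b) / 2) * (2 ^ b / fact b) = sqrt pi / Gamma (y + 1)"
  proof -
    have aux: "u * (p / f) = r / w" if "u * w * p = r * f" "w > 0" "f > 0" for u w p r f :: real
      using that by (simp add: field_simps)
    show ?thesis using Gamma_half_duplication[of b] pos(2) by (intro aux) (simp_all add: y_def)
  qed
  have "Gamma ((1 + real b) / 2) * d powr (- (1 + real b) / 2) * ((2 * g) ^ b / fact b)
           * Gamma ((1 + real b + real c) / 2)
      = (Gamma ((1 + real b) / 2) * (2 ^ b / fact b)) * (d powr (- (1 + real b) / 2) * g ^ b) * Gamma (s + y)"
    unfolding sum power_mult_distrib by simp
  also have "\<dots> = sqrt pi * d powr (- 1 / 2) * (Gamma (s + y) * t powr y / Gamma (y + 1))"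
    unfolding dup ty by simp
  also have "\<dots> \<le> sqrt pi * d powr (- 1 / 2) * (Gamma s * (1 - t) powr (- s))"
    by (intro mult_left_mono *) auto
  finally show ?thesis unfolding s_def t_def minus_divide_left .
qed

section \<open>Elimination pivots and partial products of the series terms\<close>

text \<open>
  Gaussian elimination pivots of the symmetric tridiagonal matrix with unit diagonal whose entry at
  the (0-based) position \<open>(i - 1, i)\<close> is \<open>g i\<close>; \<open>tridiag_form\<close> is its quadratic form.
\<close>

fun pivot :: "(nat \<Rightarrow> real) \<Rightarrow> nat \<Rightarrow> real" where
  "pivot g 0 = 1"
| "pivot g (Suc k) = 1 - (g (Suc k))\<^sup>2 / pivot g k"

definition tridiag_form :: "(nat \<Rightarrow> real) \<Rightarrow> nat \<Rightarrow> (nat \<Rightarrow> real) \<Rightarrow> real" where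
  "tridiag_form g k x = (\<Sum>i<k. (x i)\<^sup>2) + 2 * (\<Sum>i\<in>{1..<k}. g i * x (i - 1) * x i)"

lemma tridiag_form_Suc_Suc:
  "tridiag_form g (Suc (Suc k)) x
     = tridiag_form g (Suc k) x + (x (Suc k))\<^sup>2 + 2 * (g (Suc k) * x k * x (Suc k))"
  by (simp add: tridiag_form_def algebra_simps)

text \<open>Back substitution: once the last coordinate is fixed, each preceding one is chosen
  optimally. The value a stays arbitrary because the induction hypothesis is applied to a different
  last coordinate.\<close>

lemma tridiag_form_attains_pivot:
  assumes "\<forall>j<k. pivot g j > 0"
  shows "\<exists>x. x k = a \<and> (\<forall>i>k. x i = 0) \<and> tridiag_form g (Suc k) x = pivot g k * a\<^sup>2"
  using assms
proof (induction k arbitrary: a)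
  case 0
  show ?case by (rule exI[of _ "(\<lambda>_. 0)(0 := a)"]) (simp add: tridiag_form_def)
next
  case (Suc k)
  have p: "pivot g k > 0" using Suc.prems by simp
  \<comment> \<open>This coordinate y minimizes \<open>pivot g k\<close> * y^2 + 2 *
    \<open>g (Suc k)\<close> * y * a, with minimum -(\<open>g (Suc k)\<close> * a)^2 /
    \<open>pivot g k\<close>; adding a^2 gives the next pivot times a^2.\<close>
  obtain x where x: "x k = - g (Suc k) * a / pivot g k" "\<forall>i>k. x i = 0"
      "tridiag_form g (Suc k) x = pivot g k * (- g (Suc k) * a / pivot g k)\<^sup>2"
    using Suc by (metis less_Suc_eq)
  let ?y = "x(Suc k := a)"
  have "tridiag_form g (Suc k) ?y = tridiag_form g (Suc k) x"
    unfolding tridiag_form_def by (intro arg_cong2[of _ _ _ _ "(+)"] arg_cong2[of _ _ _ _ "(*)"] sum.cong) auto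
  then have "tridiag_form g (Suc (Suc k)) ?y = pivot g (Suc k) * a\<^sup>2"
    using p by (simp add: tridiag_form_Suc_Suc x) (simp add: field_simps power2_eq_square)
  then show ?case using x(2) by (intro exI[of _ ?y]) (simp del: pivot.simps fun_upd_apply, simp)
qed

lemma tridiag_form_extend_zero:
  assumes "\<forall>i\<ge>k. x i = 0" "k \<le> n"
  shows "tridiag_form g n x = tridiag_form g k x"
  unfolding tridiag_form_def using assms
  by (intro arg_cong2[of _ _ _ _ "(+)"] arg_cong2[of _ _ _ _ "(*)"] sum.mono_neutral_right) auto

text \<open>Each pivot is a value of the form at a nonzero vector. Building that vector divides by
  all earlier pivots, hence the strong induction.\<close>

lemma pivot_pos:
  assumes pd: "\<And>x. (\<exists>i<n. x i \<noteq> 0) \<Longrightarrow> tridiag_form g n x > 0" and "k < n"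
  shows "pivot g k > 0"
  using \<open>k < n\<close>
proof (induction k rule: less_induct)
  case (less k)
  then obtain x where x: "x k = 1" "\<forall>i>k. x i = 0" "tridiag_form g (Suc k) x = pivot g k"
    using tridiag_form_attains_pivot[of k g 1] by auto
  have "tridiag_form g n x = tridiag_form g (Suc k) x"
    using x less.prems by (intro tridiag_form_extend_zero) auto
  moreover have "tridiag_form g n x > 0" using x less.prems by (intro pd) auto
  ultimately show ?case using x by simp
qed

text \<open>The number c stands for the next index: the last Gamma factor couples it to
  \<open>b k\<close>, and in the induction step the hypothesis is used with
  \<open>c = b (Suc k)\<close>. The constant K depends on neither b nor c.\<close>

lemma series_partial_product_bound:
  assumes piv: "\<forall>j\<le>k. pivot g j > 0" and g: "\<forall>i. g i \<ge> 0"
  shows "\<exists>K\<ge>0. \<forall>b c. b 0 = 0 \<longrightarrow>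
    (\<Prod>i\<in>{1..k}. (2 * g i) ^ b i / fact (b i)) *
    (\<Prod>i\<in>{1..k}. Gamma ((1 + real (b (i - 1)) + real (b i)) / 2)) *
      Gamma ((1 + real (b k) + real c) / 2)
     \<le> K * (Gamma ((1 + real c) / 2) * pivot g k powr (- (1 + real c) / 2))"
  using piv
proof (induction k)
  case 0
  show ?case by (rule exI[of _ 1]) auto
next
  case (Suc k)
  then obtain K where K: "K \<ge> 0" "\<And>b c. b 0 = 0 \<Longrightarrow>
    (\<Prod>i\<in>{1..k}. (2 * g i) ^ b i / fact (b i)) *
    (\<Prod>i\<in>{1..k}. Gamma ((1 + real (b (i - 1)) + real (b i)) / 2)) *
      Gamma ((1 + real (b k) + real c) / 2)
     \<le> K * (Gamma ((1 + real c) / 2) * pivot g k powr (- (1 + real c) / 2))" by auto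
  define d where "d = pivot g k"
  define h where "h = g (Suc k)"
  have d: "d > 0" using Suc.prems by (simp add: d_def)
  have "1 - h\<^sup>2 / d > 0" using Suc.prems[rule_format, of "Suc k"] by (simp add: d_def h_def)
  then have hd: "h\<^sup>2 < d" using d by (simp add: field_simps)
  have h: "h \<ge> 0" using g by (simp add: h_def)
  show ?case
  proof (intro exI[of _ "K * (sqrt pi * d powr (- 1 / 2))"] conjI allI impI)
    show "K * (sqrt pi * d powr (- 1 / 2)) \<ge> 0" using K by simp
    fix b :: "nat \<Rightarrow> nat" and c :: nat
    assume b0: "b 0 = 0"
    define R where "R = (\<Prod>i\<in>{1..k}. (2 * g i) ^ b i / fact (b i)) *
      (\<Prod>i\<in>{1..k}. Gamma ((1 + real (b (i - 1)) + real (b i)) / 2))"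
    define B where "B = b (Suc k)"
    define X where "X = (2 * h) ^ B / fact B * Gamma ((1 + real B + real c) / 2)"
    have "X \<ge> 0" unfolding X_def using h by (auto intro!: mult_nonneg_nonneg Gamma_real_nonneg)
    have "(\<Prod>i\<in>{1..Suc k}. (2 * g i) ^ b i / fact (b i)) *
       (\<Prod>i\<in>{1..Suc k}. Gamma ((1 + real (b (i - 1)) + real (b i)) / 2)) *
         Gamma ((1 + real (b (Suc k)) + real c) / 2)
       = R * Gamma ((1 + real (b k) + real B) / 2) * X"
      by (simp add: R_def X_def B_def h_def prod.nat_ivl_Suc' mult_ac)
    also have "\<dots> \<le> K * (Gamma ((1 + real B) / 2) * d powr (- (1 + real B) / 2)) * X"
      using K(2)[of b B] b0 \<open>X \<ge> 0\<close> unfolding R_def d_def by (intro mult_right_mono) auto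
    also have "\<dots> = K * (Gamma ((1 + real B) / 2) * d powr (- (1 + real B) / 2) * ((2 * h) ^ B / fact B)
           * Gamma ((1 + real B + real c) / 2))" by (simp add: X_def mult_ac)
    also have "\<dots> \<le> K * (sqrt pi * d powr (- 1 / 2) * (Gamma ((1 + real c) / 2) * (1 - h\<^sup>2 / d) powr (- (1 + real c) / 2)))"
      using Gamma_term_bound[OF h d hd, of B c] K(1) by (rule mult_left_mono)
    finally show "(\<Prod>i\<in>{1..Suc k}. (2 * g i) ^ b i / fact (b i)) *
       (\<Prod>i\<in>{1..Suc k}. Gamma ((1 + real (b (i - 1)) + real (b i)) / 2)) *
         Gamma ((1 + real (b (Suc k)) + real c) / 2)
      \<le> K * (sqrt pi * d powr (- 1 / 2)) * (Gamma ((1 + real c) / 2) * pivot g (Suc k) powr (- (1 + real c) / 2))"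
      by (simp add: h_def d_def mult_ac)
  qed
qed

section \<open>Smallest eigenvalue and Rayleigh quotient\<close>

text \<open>The form attains its minimum on the compact unit sphere, and a minimizer is an
  eigenvector whose eigenvalue is that minimum. Homogeneity carries the bound to all
  vectors.\<close>

lemma quadratic_form_min_spectrum_le:
  fixes A :: "real mat" and f :: "nat \<Rightarrow> real"
  assumes A: "A \<in> carrier_mat n n"
    and sym: "\<And>i j. i < n \<Longrightarrow> j < n \<Longrightarrow> A $$ (i, j) = A $$ (j, i)"
    and n: "n > 0"
  shows "Min (spectrum A) * (\<Sum>i<n. (f i)\<^sup>2) \<le> (\<Sum>i<n. \<Sum>j<n. A $$ (i, j) * f i * f j)"
proof -
  define Q where "Q = (\<lambda>f :: nat \<Rightarrow> real. \<Sum>i<n. \<Sum>j<n. A $$ (i, j) * f i * f j)"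
  define N where "N = (\<lambda>f :: nat \<Rightarrow> real. \<Sum>i<n. (f i)\<^sup>2)"
  \<comment> \<open>The sphere lives in the product space of all real sequences. Forcing the
    coordinates from n on to be 0 puts it inside a product of compact sets, so Tychonoff gives
    compactness.\<close>
  define D where "D = (\<lambda>i. if i < n then {-1..1} else {0 :: real})"
  define S where "S = {f \<in> PiE UNIV D. N f = 1}"
  have coord: "continuous_on T (\<lambda>f :: nat \<Rightarrow> real. f i)" for T i
    by (rule continuous_on_subset[OF continuous_on_product_coordinates]) simp
  have contN: "continuous_on T N" for T
    unfolding N_def by (intro continuous_intros coord)
  have contQ: "continuous_on T Q" for T
    unfolding Q_def by (intro continuous_intros coord)
  have "compactin (product_topology (\<lambda>i. euclidean) UNIV) (PiE UNIV D)"
    unfolding compactin_PiE by (auto simp: D_def)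
  then have "compact (PiE UNIV D)"
    by (simp add: euclidean_product_topology)
  moreover have "closed {f. N f = 1}"
    by (intro closed_Collect_eq contN continuous_intros)
  ultimately have "compact (PiE UNIV D \<inter> {f. N f = 1})"
    by (rule compact_Int_closed)
  moreover have "PiE UNIV D \<inter> {f. N f = 1} = S" unfolding S_def by blast
  ultimately have "compact S" by simp
  have "(\<lambda>i. if i = 0 then 1 else 0) \<in> S"
    using n by (simp add: S_def D_def N_def PiE_UNIV_domain if_distrib[of "\<lambda>x. x\<^sup>2"] cong: if_cong)
  then have "S \<noteq> {}" by blast
  obtain e where e: "e \<in> S" "\<And>f. f \<in> S \<Longrightarrow> Q e \<le> Q f"
    using continuous_attains_inf[OF \<open>compact S\<close> \<open>S \<noteq> {}\<close> contQ] by blast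
  define m where "m = Q e"
  have Ne: "N e = 1" using e(1) by (simp add: S_def)
  have N_nonneg: "N f \<ge> 0" for f unfolding N_def by (simp add: sum_nonneg)
  have Q_scale: "Q (\<lambda>i. if i < n then a * f i else 0) = a\<^sup>2 * Q f" for a f
    unfolding Q_def by (simp add: sum_distrib_left power2_eq_square mult_ac)
  have N_scale: "N (\<lambda>i. if i < n then a * f i else 0) = a\<^sup>2 * N f" for a f
    unfolding N_def by (simp add: sum_distrib_left power_mult_distrib)
  have lower: "m * N f \<le> Q f" for f
  proof (cases "N f = 0")
    case True
    then have "\<And>i. i < n \<Longrightarrow> f i = 0"
      unfolding N_def by (subst (asm) sum_nonneg_eq_0_iff) auto
    then have "Q f = 0" unfolding Q_def by simp
    with True show ?thesis by simp
  next
    case False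
    then have pos: "N f > 0" using N_nonneg[of f] by simp
    define u where "u = (\<lambda>i. if i < n then (1 / sqrt (N f)) * f i else 0)"
    have Nu: "N u = 1" unfolding u_def N_scale using pos by (simp add: power_divide)
    have "u i \<in> D i" for i
    proof (cases "i < n")
      case True
      have "(u i)\<^sup>2 \<le> N u" unfolding N_def
        using True by (intro member_le_sum) auto
      then show ?thesis using True by (simp add: Nu D_def abs_square_le_1 abs_le_iff)
    qed (simp add: D_def u_def)
    then have "u \<in> S" using Nu by (simp add: S_def PiE_UNIV_domain)
    then have "m \<le> Q u" using e m_def by simp
    also have "\<dots> = Q f / N f" unfolding u_def Q_scale using pos by (simp add: power_divide)
    finally show ?thesis using pos by (simp add: field_simps)
  qed
  txt \<open>First-order optimality: a nonnegative quadratic form vanishing at \<open>e\<close> has \<open>e\<close> in its kernel.\<close>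
  have eig: "(\<Sum>j<n. A $$ (i, j) * e j) = m * e i" if i: "i < n" for i
  proof -
    define L where "L = (\<Sum>j<n. A $$ (i, j) * e j) - m * e i"
    define a where "a = A $$ (i, i) - m"
    have exp: "Q (e(i := e i + t)) - m * N (e(i := e i + t)) = 2 * t * L + t\<^sup>2 * a" for t
    proof -
      define w where "w = (\<lambda>j. if j = i then t else 0 :: real)"
      have w: "e(i := e i + t) = (\<lambda>j. e j + w j)" by (auto simp: w_def)
      have "Q (\<lambda>j. e j + w j) = Q e + (\<Sum>k<n. \<Sum>j<n. A $$ (k, j) * e k * w j)
          + (\<Sum>k<n. \<Sum>j<n. A $$ (k, j) * w k * e j) + (\<Sum>k<n. \<Sum>j<n. A $$ (k, j) * w k * w j)"
        unfolding Q_def by (simp add: algebra_simps sum.distrib)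
      also have "(\<Sum>k<n. \<Sum>j<n. A $$ (k, j) * e k * w j) = (\<Sum>k<n. A $$ (k, i) * e k * t)"
        using i by (simp add: w_def if_distrib[of "(*) _"] cong: if_cong)
      also have "\<dots> = t * (\<Sum>j<n. A $$ (i, j) * e j)"
        using i by (auto simp: sum_distrib_left mult_ac sym intro!: sum.cong)
      also have "(\<Sum>k<n. \<Sum>j<n. A $$ (k, j) * w k * e j) = (\<Sum>j<n. \<Sum>k<n. A $$ (k, j) * w k * e j)"
        by (rule sum.swap)
      also have "\<dots> = (\<Sum>j<n. A $$ (i, j) * t * e j)"
        using i by (simp add: w_def if_distrib[of "(*) _"] if_distrib[of "\<lambda>x. x * _"] cong: if_cong)
      also have "\<dots> = t * (\<Sum>j<n. A $$ (i, j) * e j)"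
        by (simp add: sum_distrib_left mult_ac)
      also have "(\<Sum>k<n. \<Sum>j<n. A $$ (k, j) * w k * w j) = A $$ (i, i) * t * t"
        using i by (simp add: w_def if_distrib[of "(*) _"] if_distrib[of "\<lambda>x. x * _"] cong: if_cong)
      finally have q: "Q (\<lambda>j. e j + w j) = m + 2 * t * (\<Sum>j<n. A $$ (i, j) * e j) + t\<^sup>2 * A $$ (i, i)"
        by (simp add: m_def power2_eq_square)
      have "N (\<lambda>j. e j + w j) = N e + 2 * (\<Sum>j<n. e j * w j) + (\<Sum>j<n. w j * w j)"
        unfolding N_def by (simp add: power2_eq_square algebra_simps sum.distrib sum_distrib_left)
      also have "\<dots> = 1 + 2 * (e i * t) + t * t"
        using i by (simp add: Ne w_def if_distrib[of "(*) _"] cong: if_cong)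
      finally have "N (\<lambda>j. e j + w j) = 1 + 2 * (e i * t) + t * t" .
      with q show ?thesis unfolding w L_def a_def by (simp add: algebra_simps power2_eq_square)
    qed
    have pos: "2 * t * L + t\<^sup>2 * a \<ge> 0" for t using lower[of "e(i := e i + t)"] exp[of t] by simp
    have "L = 0"
    proof (rule ccontr)
      assume "L \<noteq> 0"
      \<comment> \<open>At t = -L/r the expression is (L/r)^2 * (a - 2r), negative as soon as 2r
        exceeds a.\<close>
      define r where "r = \<bar>a\<bar> + 1"
      have r: "r > 0" "a < 2 * r" by (auto simp: r_def)
      have "2 * (- L / r) * L + (- L / r)\<^sup>2 * a = (L / r)\<^sup>2 * (a - 2 * r)"
        using r(1) by (simp add: field_simps power2_eq_square)
      moreover have "(L / r)\<^sup>2 * (a - 2 * r) < 0"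
        using \<open>L \<noteq> 0\<close> r by (intro mult_pos_neg) auto
      ultimately show False using pos[of "- L / r"] by simp
    qed
    then show ?thesis by (simp add: L_def)
  qed
  have "eigenvector A (vec n e) m"
    unfolding eigenvector_def
  proof (intro conjI)
    show "vec n e \<in> carrier_vec (dim_row A)" using A by simp
    show "vec n e \<noteq> 0\<^sub>v (dim_row A)"
    proof
      assume "vec n e = 0\<^sub>v (dim_row A)"
      then have "e i = 0" if "i < n" for i using that A by (metis carrier_matD(1) index_vec index_zero_vec(1))
      then have "N e = 0" by (simp add: N_def)
      with Ne show False by simp
    qed
    show "A *\<^sub>v vec n e = m \<cdot>\<^sub>v vec n e"
      using A eig by (intro eq_vecI) (auto simp: scalar_prod_def lessThan_atLeast0)
  qed
  then have "m \<in> spectrum A" by (auto simp: spectrum_def eigenvalue_def)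
  then have "Min (spectrum A) \<le> m" using card_finite_spectrum(1)[OF A] by simp
  then have "Min (spectrum A) * N f \<le> m * N f" using N_nonneg by (rule mult_right_mono)
  also have "\<dots> \<le> Q f" by (rule lower)
  finally show ?thesis by (simp add: N_def Q_def)
qed

section \<open>Termwise bound and geometric decay of the truncation error\<close>

text \<open>Pivots see only squares of the off-diagonal entries, so passing to absolute values meets
  the sign hypothesis of \<open>series_partial_product_bound\<close>.\<close>

lemma pivot_abs: "pivot (\<lambda>i. \<bar>g i\<bar>) k = pivot g k"
  by (induction k) auto

lemma series_term_bound:
  assumes n: "n \<ge> 1" and \<sigma>: "\<sigma> > 0" and piv: "\<forall>j<n. pivot (\<lambda>i. \<beta> i / \<sigma>) j > 0"
  shows "\<exists>K\<ge>0. \<forall>b\<in>multi_indices n.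
    \<bar>series_coeff n b * monomial_at n \<beta> b\<bar> \<le> K * \<sigma> ^ (\<Sum>i\<in>{1..<n}. b i)"
proof -
  obtain k where k: "n = Suc k" using n by (cases n) auto
  define g where "g = (\<lambda>i. \<bar>\<beta> i / \<sigma>\<bar>)"
  have "\<forall>j\<le>k. pivot g j > 0" using piv unfolding g_def pivot_abs k by auto
  then obtain K where K: "K \<ge> 0" "\<And>b c. b 0 = 0 \<Longrightarrow>
    (\<Prod>i\<in>{1..k}. (2 * g i) ^ b i / fact (b i)) *
    (\<Prod>i\<in>{1..k}. Gamma ((1 + real (b (i - 1)) + real (b i)) / 2)) *
      Gamma ((1 + real (b k) + real c) / 2)
     \<le> K * (Gamma ((1 + real c) / 2) * pivot g k powr (- (1 + real c) / 2))"
    using series_partial_product_bound[of k g] by (auto simp: g_def)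
  define K' where "K' = K * (Gamma (1 / 2) * pivot g k powr (- 1 / 2))"
  have "K' \<ge> 0" using K(1) by (simp add: K'_def Gamma_one_half_real)
  moreover have "\<bar>series_coeff n b * monomial_at n \<beta> b\<bar> \<le> K' * \<sigma> ^ (\<Sum>i\<in>{1..<n}. b i)"
    if "b \<in> multi_indices n" for b
  proof -
    have b: "b 0 = 0" "b (Suc k) = 0" using that by (auto simp: multi_indices_def k)
    define P where "P = (\<Prod>i\<in>{1..n}. Gamma ((1 + real (b (i - 1)) + real (b i)) / 2))"
    have P0: "P \<ge> 0" unfolding P_def by (intro prod_nonneg ballI Gamma_real_nonneg) auto
    have P: "P = (\<Prod>i\<in>{1..k}. Gamma ((1 + real (b (i - 1)) + real (b i)) / 2)) *
      Gamma ((1 + real (b k) + real (0 :: nat)) / 2)"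
      unfolding P_def k by (simp add: prod.nat_ivl_Suc' b mult_ac)
    \<comment> \<open>The choice \<open>c = 0\<close> is the convention that the index at position n
      vanishes; it turns the coupling factor into the last Gamma factor of P.\<close>
    have "(\<Prod>i\<in>{1..k}. (2 * g i) ^ b i / fact (b i)) * P \<le> K'"
      using K(2)[of b 0] b(1) by (simp add: P K'_def mult_ac)
    then have le: "(\<Prod>i\<in>{1..k}. (2 * g i) ^ b i / fact (b i)) * P * \<sigma> ^ (\<Sum>i\<in>{1..<n}. b i)
      \<le> K' * \<sigma> ^ (\<Sum>i\<in>{1..<n}. b i)"
      using \<sigma> by (intro mult_right_mono) auto
    have "\<bar>series_coeff n b * monomial_at n \<beta> b\<bar>
      = (\<Prod>i\<in>{1..k}. 2 ^ b i * \<bar>\<beta> i\<bar> ^ b i / fact (b i)) * P"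
      unfolding series_coeff_def monomial_at_def P_def[symmetric]
      unfolding k atLeastLessThanSuc_atLeastAtMost
      using P0
      by (simp add: abs_mult power_abs abs_prod prod_dividef prod.distrib power_sum prod_nonneg)
    also have "(\<Prod>i\<in>{1..k}. 2 ^ b i * \<bar>\<beta> i\<bar> ^ b i / fact (b i))
      = (\<Prod>i\<in>{1..k}. ((2 * g i) ^ b i / fact (b i)) * \<sigma> ^ b i)"
      using \<sigma> by (intro prod.cong) (auto simp: g_def power_mult_distrib power_divide)
    also have "\<dots> = (\<Prod>i\<in>{1..k}. (2 * g i) ^ b i / fact (b i)) * \<sigma> ^ (\<Sum>i\<in>{1..<n}. b i)"
      unfolding k atLeastLessThanSuc_atLeastAtMost by (simp only: prod.distrib power_sum)
    finally show ?thesis using le by (simp add: mult_ac)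
  qed
  ultimately show ?thesis by blast
qed

text \<open>A finite set of multi-indices lies in a box, over which the sum factors into n - 1
  finite geometric sums.\<close>

lemma geometric_multi_index_sum_le:
  fixes r :: real
  assumes r: "0 \<le> r" "r < 1" and F: "finite F" "F \<subseteq> multi_indices n"
  shows "(\<Sum>b\<in>F. r ^ (\<Sum>i\<in>{1..<n}. b i)) \<le> (1 / (1 - r)) ^ (n - 1)"
proof -
  define I where "I = {1..<n}"
  define M where "M = (\<Sum>b\<in>F. \<Sum>i\<in>I. b i)"
  \<comment> \<open>Multi-indices are 0 outside I, whereas members of \<open>PiE\<close> are
    \<open>undefined\<close> there; \<open>restrict\<close> translates between the two.\<close>
  define \<phi> where "\<phi> = (\<lambda>b :: nat \<Rightarrow> nat. restrict b I)"
  have fin: "finite I" by (simp add: I_def)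
  have "b i \<le> M" if "b \<in> F" "i \<in> I" for b i
  proof -
    have "b i \<le> (\<Sum>i\<in>I. b i)" using that fin by (intro member_le_sum) auto
    also have "\<dots> \<le> M" unfolding M_def using that F by (intro member_le_sum) auto
    finally show ?thesis .
  qed
  then have sub: "\<phi> ` F \<subseteq> (\<Pi>\<^sub>E i\<in>I. {..M})" by (auto simp: \<phi>_def)
  have inj: "inj_on \<phi> F"
  proof (rule inj_onI)
    fix a b assume ab: "a \<in> F" "b \<in> F" "\<phi> a = \<phi> b"
    have "a i = b i" for i
    proof (cases "i \<in> I")
      case True
      then show ?thesis using fun_cong[OF ab(3), of i] by (simp add: \<phi>_def)
    next
      case False
      moreover have "a \<in> multi_indices n" "b \<in> multi_indices n" using ab F(2) by auto
      ultimately show ?thesis unfolding multi_indices_def I_def by simp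
    qed
    then show "a = b" by blast
  qed
  have "(\<Sum>b\<in>F. r ^ (\<Sum>i\<in>I. b i)) = (\<Sum>b\<in>F. \<Prod>i\<in>I. r ^ (\<phi> b i))"
    by (intro sum.cong refl) (auto simp: power_sum \<phi>_def intro!: prod.cong)
  also have "\<dots> = (\<Sum>f\<in>\<phi> ` F. \<Prod>i\<in>I. r ^ f i)"
    by (simp add: sum.reindex[OF inj])
  also have "\<dots> \<le> (\<Sum>f\<in>(\<Pi>\<^sub>E i\<in>I. {..M}). \<Prod>i\<in>I. r ^ f i)"
    using r fin by (intro sum_mono2 sub finite_PiE prod_nonneg ballI) auto
  also have "\<dots> = (\<Prod>i\<in>I. \<Sum>j\<le>M. r ^ j)"
    using fin by (subst prod_sum_PiE) auto
  also have "\<dots> \<le> (\<Prod>i\<in>I. 1 / (1 - r))"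
  proof (intro prod_mono conjI)
    show "(\<Sum>j\<le>M. r ^ j) \<le> 1 / (1 - r)"
      using r by (simp add: sum_gp0 divide_right_mono)
  qed (use r in \<open>auto intro!: sum_nonneg\<close>)
  also have "\<dots> = (1 / (1 - r)) ^ (n - 1)" by (simp add: I_def)
  finally show ?thesis by (simp add: I_def)
qed

text \<open>Split \<sigma>^s as \<tau>^s * (\<sigma>/\<tau>)^s, where s is the total degree. Some
  index is at least m, so the first factor is at most \<tau>^m; the second is summable over all
  multi-indices.\<close>

lemma trunc_error_geometric:
  assumes K: "K \<ge> 0"
    and bound: "\<forall>b\<in>multi_indices n.
      \<bar>series_coeff n b * monomial_at n \<beta> b\<bar> \<le> K * \<sigma> ^ (\<Sum>i\<in>{1..<n}. b i)"
    and \<sigma>: "0 < \<sigma>" "\<sigma> < \<tau>" and \<tau>: "\<tau> \<le> 1"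
  shows "trunc_error n \<beta> (\<lambda>_. m) \<le> ennreal (K * (1 / (1 - \<sigma> / \<tau>)) ^ (n - 1) * \<tau> ^ m)"
  unfolding trunc_error_def
proof (rule infsum_le_finite_sums)
  fix F assume F: "finite F" "F \<subseteq> trunc_indices n (\<lambda>_. m)"
  have mi: "F \<subseteq> multi_indices n" using F(2) by (auto simp: trunc_indices_def)
  have "\<bar>series_coeff n b * monomial_at n \<beta> b\<bar> \<le> K * \<tau> ^ m * (\<sigma> / \<tau>) ^ (\<Sum>i\<in>{1..<n}. b i)"
    if "b \<in> F" for b
  proof -
    define s where "s = (\<Sum>i\<in>{1..<n}. b i)"
    obtain i where i: "i \<in> {1..<n}" "m \<le> b i"
      using F(2) \<open>b \<in> F\<close> by (auto simp: trunc_indices_def)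
    have "b i \<le> s" unfolding s_def using i by (intro member_le_sum) auto
    then have "\<tau> ^ s \<le> \<tau> ^ m" using i \<sigma> \<tau> by (intro power_decreasing) auto
    then have "K * \<tau> ^ s * (\<sigma> / \<tau>) ^ s \<le> K * \<tau> ^ m * (\<sigma> / \<tau>) ^ s"
      using K \<sigma> by (intro mult_right_mono mult_left_mono) auto
    moreover have "K * \<tau> ^ s * (\<sigma> / \<tau>) ^ s = K * \<sigma> ^ s"
      using \<sigma> by (simp add: power_divide)
    moreover have "\<bar>series_coeff n b * monomial_at n \<beta> b\<bar> \<le> K * \<sigma> ^ s"
      using bound mi \<open>b \<in> F\<close> unfolding s_def by blast
    ultimately show ?thesis unfolding s_def[symmetric] by linarith
  qed
  then have "(\<Sum>b\<in>F. \<bar>series_coeff n b * monomial_at n \<beta> b\<bar>)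
      \<le> (\<Sum>b\<in>F. K * \<tau> ^ m * (\<sigma> / \<tau>) ^ (\<Sum>i\<in>{1..<n}. b i))"
    by (rule sum_mono)
  also have "\<dots> = K * \<tau> ^ m * (\<Sum>b\<in>F. (\<sigma> / \<tau>) ^ (\<Sum>i\<in>{1..<n}. b i))"
    by (simp add: sum_distrib_left)
  also have "\<dots> \<le> K * \<tau> ^ m * (1 / (1 - \<sigma> / \<tau>)) ^ (n - 1)"
    using K \<sigma> by (intro mult_left_mono geometric_multi_index_sum_le F(1) mi) auto
  finally show "(\<Sum>b\<in>F. ennreal \<bar>series_coeff n b * monomial_at n \<beta> b\<bar>)
      \<le> ennreal (K * (1 / (1 - \<sigma> / \<tau>)) ^ (n - 1) * \<tau> ^ m)"
    by (subst sum_ennreal) (auto simp: mult_ac intro!: ennreal_leI)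
qed (simp add: nonneg_summable_on_complete)

section \<open>Choice of the partial degrees for the Gram matrix\<close>

lemma null_sequence_attains_max:
  fixes f :: "nat \<Rightarrow> real"
  assumes nonneg: "\<And>k. f k \<ge> 0" and lim: "f \<longlonglongrightarrow> 0"
  shows "\<exists>m. \<forall>k. f k \<le> f m"
proof (cases "\<exists>j. f j > 0")
  case False
  then have "f k \<le> f 0" for k using nonneg[of 0] by (meson not_less order_trans)
  then show ?thesis by blast
next
  case True
  then obtain j where j: "f j > 0" by blast
  then have "\<forall>\<^sub>F k in sequentially. f k < f j" using lim by (rule order_tendstoD(2)[rotated])
  then obtain M where M: "\<And>k. k \<ge> M \<Longrightarrow> f k < f j" by (auto simp: eventually_sequentially)
  \<comment> \<open>The bound \<open>max M j\<close> keeps j in the segment, so the maximum also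
    dominates the tail, which lies below \<open>f j\<close>.\<close>
  let ?S = "f ` {..max M j}"
  have "Max ?S \<in> ?S" by (intro Max_in) auto
  then obtain m where m: "f m = Max ?S" by (metis imageE)
  have le: "f k \<le> f m" if "k \<le> max M j" for k unfolding m using that by (intro Max_ge) auto
  have "f k \<le> f m" for k
    using le[of k] le[of j] M[of k] by (cases "k \<le> max M j") force+
  then show ?thesis by blast
qed

text \<open>Induction on the leading block: a new row and column add one diagonal square and, by
  symmetry, twice the product with the preceding coordinate. Positions count from 0, while g counts
  from 1.\<close>

lemma tridiagonal_quadratic_form:
  fixes A :: "nat \<Rightarrow> nat \<Rightarrow> real"
  assumes diag: "\<And>i. i < n \<Longrightarrow> A i i = 1"
    and sym: "\<And>i j. i < n \<Longrightarrow> j < n \<Longrightarrow> A i j = A j i"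
    and off: "\<And>i. Suc i < n \<Longrightarrow> A i (Suc i) = g (Suc i)"
    and far: "\<And>i j. j < n \<Longrightarrow> Suc i < j \<Longrightarrow> A i j = 0"
  shows "(\<Sum>i<n. \<Sum>j<n. A i j * f i * f j) = tridiag_form g n f"
proof -
  have "(\<Sum>i<k. \<Sum>j<k. A i j * f i * f j) = tridiag_form g k f" if "k \<le> n" for k
    using that
  proof (induction k)
    case 0
    show ?case by (simp add: tridiag_form_def)
  next
    case (Suc k)
    have "(\<Sum>j<k. A k j * f k * f j) = (\<Sum>i<k. A i k * f i * f k)"
      using Suc.prems sym by (intro sum.cong) auto
    then have split: "(\<Sum>i<Suc k. \<Sum>j<Suc k. A i j * f i * f j)
        = tridiag_form g k f + 2 * (\<Sum>i<k. A i k * f i * f k) + (f k)\<^sup>2"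
      using Suc diag[of k] by (simp add: sum.distrib power2_eq_square)
    show ?case
    proof (cases k)
      case 0
      then show ?thesis using split by (simp add: tridiag_form_def)
    next
      case (Suc l)
      have "(\<Sum>i<l. A i k * f i * f k) = 0"
        using far Suc \<open>Suc k \<le> n\<close> by (intro sum.neutral) auto
      then have "(\<Sum>i<k. A i k * f i * f k) = g k * f l * f k"
        using off[of l] Suc \<open>Suc k \<le> n\<close> by simp
      then show ?thesis using split unfolding Suc tridiag_form_Suc_Suc by simp
    qed
  qed
  then show ?thesis by simp
qed

text \<open>Only the off-diagonal part, the form minus the sum of squares, is scaled.\<close>

lemma tridiag_form_divide:
  "tridiag_form (\<lambda>i. g i / s) n x
     = (\<Sum>i<n. (x i)\<^sup>2) + (tridiag_form g n x - (\<Sum>i<n. (x i)\<^sup>2)) / s"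
  by (simp add: tridiag_form_def flip: sum_divide_distrib)

theorem theorem4p9:
  fixes n :: nat and v :: "nat \<Rightarrow> real vec" and V :: "real mat"
    and \<beta> :: "nat \<Rightarrow> real" and lam_min \<rho> :: real
  assumes n: "n \<ge> 2"
    and dim: "\<And>i. i \<in> {1..n} \<Longrightarrow> v i \<in> carrier_vec n"
    and indep: "lin_indpt_family n v"
    and unit: "\<And>i. i \<in> {1..n} \<Longrightarrow> sqrt (v i \<bullet> v i) = 1"
    and not_orthogonal: "\<exists>i\<in>{1..n}. \<exists>j\<in>{1..n}. i \<noteq> j \<and> v i \<bullet> v j \<noteq> 0"
    and V: "V = mat_of_cols n (map v [1..<n + 1])"
    and tridiagonal:
      "\<And>i j. i \<in> {1..n} \<Longrightarrow> j \<in> {1..n} \<Longrightarrow> \<bar>int i - int j\<bar> \<ge> 2 \<Longrightarrow> v i \<bullet> v j = 0"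
    and \<beta>: "\<And>i. i \<in> {1..n - 1} \<Longrightarrow> \<beta> i = v i \<bullet> v (i + 1)"
    and lam_min: "lam_min = Min (spectrum (transpose_mat V * V))"
    and \<rho>: "1 - lam_min < \<rho>" "\<rho> < 1"
  shows "\<exists>N :: nat \<Rightarrow> nat. trunc_error n \<beta> N < \<infinity> \<and>
    (\<forall>l\<ge>1. trunc_error n \<beta> (\<lambda>i. N i + l) \<le> ennreal (\<rho> ^ l) * trunc_error n \<beta> N)"
proof -
  define G where "G = transpose_mat V * V"
  have Vc: "V \<in> carrier_mat n n" unfolding V using mat_of_cols_carrier(1)[of n "map v [1..<n + 1]"] by (simp del: upt_Suc)
  have G: "G \<in> carrier_mat n n" using Vc by (simp add: G_def)
  have colV: "col V i = v (Suc i)" if "i < n" for i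
    unfolding V using that dim[of "Suc i"] by (subst col_mat_of_cols) (auto simp del: upt_Suc)
  have Gij: "G $$ (i, j) = v (Suc i) \<bullet> v (Suc j)" if "i < n" "j < n" for i j
    using that Vc by (simp add: G_def colV)
  have sym: "G $$ (i, j) = G $$ (j, i)" if "i < n" "j < n" for i j
    using that dim[of "Suc i"] dim[of "Suc j"] by (simp add: Gij comm_scalar_prod[of _ n])
  have form: "(\<Sum>i<n. \<Sum>j<n. G $$ (i, j) * f i * f j) = tridiag_form \<beta> n f" for f
  proof (rule tridiagonal_quadratic_form[where A = "\<lambda>i j. G $$ (i, j)", OF _ sym])
    show "G $$ (i, i) = 1" if "i < n" for i using that unit[of "Suc i"] by (simp add: Gij)
    show "G $$ (i, Suc i) = \<beta> (Suc i)" if "Suc i < n" for i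
      using that \<beta>[of "Suc i"] by (simp add: Gij)
    show "G $$ (i, j) = 0" if "j < n" "Suc i < j" for i j
      using that tridiagonal[of "Suc i" "Suc j"] by (simp add: Gij)
  qed
  have rayleigh: "lam_min * (\<Sum>i<n. (f i)\<^sup>2) \<le> tridiag_form \<beta> n f" for f
    using quadratic_form_min_spectrum_le[OF G sym, of f] n unfolding lam_min G_def[symmetric] form by simp
  \<comment> \<open>Test the Rayleigh bound on the first basis vector, where the form is 1; this
    makes \<sigma> positive.\<close>
  have "lam_min \<le> 1"
  proof -
    define f where "f = (\<lambda>i :: nat. if i = 0 then 1 else 0 :: real)"
    have "tridiag_form \<beta> n f = tridiag_form \<beta> 1 f"
      using n by (intro tridiag_form_extend_zero) (auto simp: f_def)
    moreover have "(\<Sum>i<n. (f i)\<^sup>2) = (1 :: real)"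
      using n by (simp add: f_def if_distrib[of "\<lambda>x. x\<^sup>2"] cong: if_cong)
    ultimately show ?thesis using rayleigh[of f] by (simp add: tridiag_form_def f_def)
  qed
  define \<sigma> where "\<sigma> = (1 - lam_min + \<rho>) / 2"
  define \<tau> where "\<tau> = (\<sigma> + \<rho>) / 2"
  have \<sigma>: "0 < \<sigma>" "1 - lam_min < \<sigma>" "\<sigma> < \<tau>" and \<tau>: "\<tau> < \<rho>"
    using \<rho> \<open>lam_min \<le> 1\<close> by (auto simp: \<sigma>_def \<tau>_def)
  have "tridiag_form (\<lambda>i. \<beta> i / \<sigma>) n x > 0" if "\<exists>i<n. x i \<noteq> 0" for x
  proof -
    define s where "s = (\<Sum>i<n. (x i)\<^sup>2)"
    have s: "s > 0" unfolding s_def using that by (metis (no_types, lifting) finite_lessThan lessThan_iff sum_pos2 zero_le_power2 zero_less_power2)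
    have "(1 - lam_min) * s < \<sigma> * s" using s \<sigma> by simp
    \<comment> \<open>The right-hand side is \<sigma> times the form for \<beta> / \<sigma>, and is
      at least (\<sigma> - (1 - \<open>lam_min\<close>)) * s.\<close>
    then have "0 < \<sigma> * s + (tridiag_form \<beta> n x - s)"
      using rayleigh[of x] by (simp add: s_def[symmetric] algebra_simps)
    then show ?thesis unfolding tridiag_form_divide s_def[symmetric] using \<sigma>(1) by (simp add: field_simps)
  qed
  then have "\<forall>j<n. pivot (\<lambda>i. \<beta> i / \<sigma>) j > 0" using pivot_pos by blast
  then obtain K where K: "K \<ge> 0" "\<forall>b\<in>multi_indices n.
      \<bar>series_coeff n b * monomial_at n \<beta> b\<bar> \<le> K * \<sigma> ^ (\<Sum>i\<in>{1..<n}. b i)"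
    using series_term_bound[of n \<sigma> \<beta>] n \<sigma> by auto
  define E where "E = (\<lambda>m. trunc_error n \<beta> (\<lambda>_. m))"
  define C where "C = K * (1 / (1 - \<sigma> / \<tau>)) ^ (n - 1)"
  have C: "C \<ge> 0" using K(1) \<sigma> by (simp add: C_def)
  have E_le: "E m \<le> ennreal (C * \<tau> ^ m)" for m
    unfolding E_def C_def using trunc_error_geometric[OF K \<sigma>(1,3)] \<tau> \<rho> by simp
  \<comment> \<open>\<open>enn2real\<close> sends infinity to 0, so real inequalities for it lift
    back to \<open>ennreal\<close> only once finiteness is known.\<close>
  have E_fin: "E m < \<infinity>" for m
    using le_less_trans[OF E_le ennreal_less_top] by simp
  define f where "f = (\<lambda>m. enn2real (E m) / \<rho> ^ m)"
  have \<rho>0: "\<rho> > 0" using \<sigma> \<tau> by simp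
  have f0: "f m \<ge> 0" for m using \<rho>0 by (simp add: f_def)
  have f_le: "f m \<le> C * (\<tau> / \<rho>) ^ m" for m
  proof -
    have "enn2real (E m) \<le> C * \<tau> ^ m"
      using E_le[of m] C \<sigma> by (intro enn2real_leI) auto
    then show ?thesis using \<rho>0 by (simp add: f_def power_divide divide_right_mono)
  qed
  have "(\<lambda>m. (\<tau> / \<rho>) ^ m) \<longlonglongrightarrow> 0"
    using \<tau> \<sigma> \<rho>0 by (intro LIMSEQ_realpow_zero) auto
  then have lim: "(\<lambda>m. C * (\<tau> / \<rho>) ^ m) \<longlonglongrightarrow> 0"
    by (rule tendsto_mult_right_zero)
  have "f \<longlonglongrightarrow> 0"
    by (rule real_tendsto_sandwich[OF _ _ tendsto_const lim]) (simp_all add: f0 f_le)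
  then obtain m where m: "\<And>k. f k \<le> f m" using null_sequence_attains_max f0 by blast
  have "E (m + l) \<le> ennreal (\<rho> ^ l) * E m" for l
  proof -
    have "enn2real (E (m + l)) \<le> \<rho> ^ l * enn2real (E m)"
      using m[of "m + l"] \<rho>0 by (simp add: f_def power_add field_simps)
    then have "ennreal (enn2real (E (m + l))) \<le> ennreal (\<rho> ^ l) * ennreal (enn2real (E m))"
      using \<rho>0 by (simp add: ennreal_leI flip: ennreal_mult)
    then show ?thesis using E_fin by simp
  qed
  then show ?thesis using E_fin unfolding E_def by (intro exI[of _ "\<lambda>_. m"]) auto
qed

end
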